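(* Let $X$ be a real Banach space with dual $X^*$, let $1\le p<\infty$ be given, and let $A\colon X\rightrightarrows X^*$ be monotone. (i) Suppose that for all $z\in X$ with $z\notin\overline{\operatorname{dom} A}$ and all sufficiently large $\lambda>0$, the operator $A+\lambda J_p(\cdot-z)$ is maximally monotone. Then $\operatorname{dom} A$ is nearly convex, since $$\overline{\operatorname{dom} A}=\overline{\operatorname{conv}[\operatorname{dom} A]}=\overline{P_X[\operatorname{dom} F_A]}.$$ (ii) Suppose only that for all $z\in X$ with $z\notin\overline{\operatorname{conv}[\operatorname{dom} A]}$ and all sufficiently large $\lambda>0$, the point $(z,0)$ is not monotonically related to $\operatorname{gra}\big(A+\lambda J_p(\cdot-z)\big)$. Then $$\overline{\operatorname{conv}[\operatorname{dom} A]}=\overline{P_X[\operatorname{dom} F_A]}.$$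
   Context: $X$ is a real Banach space with norm $\|\cdot\|$, $X^*$ its continuous dual, $\langle\cdot,\cdot\rangle$ the duality pairing. A set-valued operator $A\colon X\rightrightarrows X^*$ assigns to each $x\in X$ a (possibly empty) subset $Ax\subseteq X^*$; $\operatorname{gra}A=\{(x,x^* )\in X\times X^*: x^*\in Ax\}$ and $\operatorname{dom}A=\{x\in X: Ax\ne\varnothing\}$. $A$ is monotone if $\langle x-y,x^*-y^*\rangle\ge 0$ for all $(x,x^* ),(y,y^* )\in\operatorname{gra}A$, and maximally monotone if it is monotone and no monotone operator has a graph properly containing $\operatorname{gra}A$. A point $(x,x^* )\in X\times X^*$ is monotonically related to $\operatorname{gra}A$ if $\langle x-y,x^*-y^*\rangle\ge0$ for all $(y,y^* )\in\operatorname{gra}A$. Sums of operators are pointwise: $(A+B)x=\{a^*+b^*: a^*\in Ax,\ b^*\in Bx\}$. For $\operatorname{gra}A\neq\varnothing$, the Fitzpatrick function $F_A\colon X\times X^*\to\,]-\infty,+\infty]$ is $F_A(x,x^* )=\sup_{(a,a^* )\in\operatorname{gra}A}\big(\langle x,a^*\rangle+\langle a,x^*\rangle-\langle a,a^*\rangle\big)$, with $\operatorname{dom}F_A=\{(x,x^* ): F_A(x,x^* )\in\mathbb R\}$. $P_X\colon X\times X^*\to X$, $(x,x^* )\mapsto x$. For a proper $f\colon X\to\,]-\infty,+\infty]$, $\partial f(x)=\{x^*\in X^*: \langle y-x,x^*\rangle+f(x)\le f(y)\ \forall y\in X\}$. $J_p:=\frac1p\,\partial\|\cdot\|^p$, and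 $J_p(\cdot-z)$ denotes the operator $x\mapsto J_p(x-z)$. $\overline{C}$ is the norm closure and $\operatorname{conv}C$ the convex hull of $C$. A set $C$ is nearly convex if $\overline{C}$ is convex. *)

theory Defs
  imports "HOL-Analysis.Analysis"
begin

type_synonym 'a dual = "'a \<Rightarrow>\<^sub>L real"

type_synonym 'a oper = "'a \<Rightarrow> 'a dual set"

definition gra :: "'a::real_normed_vector oper \<Rightarrow> ('a \<times> 'a dual) set" where
  "gra A = {(x, x'). x' \<in> A x}"

definition dom_op :: "'a::real_normed_vector oper \<Rightarrow> 'a set" where
  "dom_op A = {x. A x \<noteq> {}}"

definition monotone_op :: "'a::real_normed_vector oper \<Rightarrow> bool" where
  "monotone_op A \<longleftrightarrow>
     (\<forall>(x, x') \<in> gra A. \<forall>(y, y') \<in> gra A. blinfun_apply (x' - y') (x - y) \<ge> 0)"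

definition maximally_monotone :: "'a::real_normed_vector oper \<Rightarrow> bool" where
  "maximally_monotone A \<longleftrightarrow>
     monotone_op A \<and> \<not> (\<exists>B. monotone_op B \<and> gra A \<subset> gra B)"

definition monotonically_related ::
    "'a::real_normed_vector \<times> 'a dual \<Rightarrow> ('a \<times> 'a dual) set \<Rightarrow> bool" where
  "monotonically_related = (\<lambda>(x, x') G. \<forall>(y, y') \<in> G. blinfun_apply (x' - y') (x - y) \<ge> 0)"

definition sum_op ::
    "'a::real_normed_vector oper \<Rightarrow> 'a oper \<Rightarrow> 'a oper" where
  "sum_op A B = (\<lambda>x. {a' + b' | a' b'. a' \<in> A x \<and> b' \<in> B x})"

definition scale_op :: "real \<Rightarrow> 'a::real_normed_vector oper \<Rightarrow> 'a oper" where
  "scale_op c A = (\<lambda>x. (\<lambda>x'. c *\<^sub>R x') ` A x)"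

text \<open>For an operator with empty graph the supremum is \<open>-\<infinity>\<close>; its domain below is then empty.\<close>

definition fitzpatrick :: "'a::real_normed_vector oper \<Rightarrow> 'a \<times> 'a dual \<Rightarrow> ereal" where
  "fitzpatrick A = (\<lambda>(x, x'). SUP (a, a') \<in> gra A.
     ereal (blinfun_apply a' x + blinfun_apply x' a - blinfun_apply a' a))"

definition dom_fitzpatrick :: "'a::real_normed_vector oper \<Rightarrow> ('a \<times> 'a dual) set" where
  "dom_fitzpatrick A = {w. \<bar>fitzpatrick A w\<bar> \<noteq> \<infinity>}"

text \<open>Intended for proper functions with values in \<open>]-\<infinity>, +\<infinity>]\<close>.\<close>

definition subdifferential :: "('a::real_normed_vector \<Rightarrow> ereal) \<Rightarrow> 'a oper" where
  "subdifferential f = (\<lambda>x. {x'. \<forall>y. ereal (blinfun_apply x' (y - x)) + f x \<le> f y})"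

definition J :: "real \<Rightarrow> 'a::real_normed_vector oper" where
  "J p = scale_op (1 / p) (subdifferential (\<lambda>x. ereal (norm x powr p)))"

definition nearly_convex :: "'a::real_normed_vector set \<Rightarrow> bool" where
  "nearly_convex C \<longleftrightarrow> convex (closure C)"

end

theory Submission
  imports Defs
begin

text \<open>
  Everything rests on comparing the size of the Fitzpatrick function \<open>F\<close> of \<open>A\<close> with the growth of
  \<open>J p\<close>.  The inclusion of the convex hull of \<open>dom_op A\<close> in the projected domain of \<open>F\<close> is soft: by
  monotonicity \<open>F (a, a') \<le> a' a\<close> on the graph, and \<open>F\<close> is a supremum of affine functions, so its
  domain is convex.

  For the converse, let \<open>z\<close> lie outside the closure of \<open>dom_op A\<close>, at distance at least \<open>d > 0\<close>.  If
  \<open>(z, 0)\<close> is not monotonically related to the graph of \<open>A + c J\<^sub>p(\<cdot> - z)\<close>, the violating pair is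
  built from some \<open>(a, a')\<close> in the graph of \<open>A\<close> with
  \<open>a' (z - a) > (c / p) \<parallel>a - z\<parallel>\<^sup>p \<ge> (c / p) d\<^sup>p\<^sup>-\<^sup>1 \<parallel>a - z\<parallel>\<close>.  The affine function belonging to \<open>(a, a')\<close>
  takes at \<open>(z, z')\<close> the value \<open>a' (z - a) + z' (a - z) + z' z\<close>, hence for large \<open>c\<close> \<open>F (z, z')\<close> exceeds
  \<open>d ((c / p) d\<^sup>p\<^sup>-\<^sup>1 - \<parallel>z'\<parallel>) + z' z\<close>.  This is unbounded in \<open>c\<close>, so \<open>F (z, z') = \<infinity>\<close> for every \<open>z'\<close>
  and \<open>z\<close> is not in the projected domain.

  Both parts are instances of this estimate, with the closure of \<open>dom_op A\<close> in the first and that of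
  its convex hull in the second.  In the first part maximality provides the violating pair: \<open>z\<close> is
  not in the domain of the sum, whereas a maximally monotone graph contains every point that is
  monotonically related to it.
\<close>

lemma maximally_monotone_contains_related:
  assumes "maximally_monotone S" and "monotonically_related (z, z') (gra S)"
  shows "z' \<in> S z"
proof (rule ccontr)
  assume notin: "z' \<notin> S z"
  define B where "B = S(z := insert z' (S z))"
  have gB: "gra B = insert (z, z') (gra S)"
    by (auto simp: gra_def B_def split: if_splits)
  have flip: "blinfun_apply (y' - z') (y - z) = blinfun_apply (z' - y') (z - y)" for y y'
    by (simp add: blinfun.diff_left blinfun.diff_right)
  have "monotone_op B"
    using assms unfolding monotone_op_def gB maximally_monotone_def monotonically_related_def
    by (auto simp: flip)
  moreover have "gra S \<subset> gra B"
    unfolding gB using notin by (auto simp: gra_def)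
  ultimately show False
    using assms(1) by (auto simp: maximally_monotone_def)
qed

text \<open>Testing the subgradient inequality at \<open>y = 0\<close> loses the factor \<open>1 / p\<close> against the exact value
  \<open>\<parallel>u\<parallel>\<^sup>p\<close> of the pairing; only the order of growth matters below.\<close>

lemma J_pairing_lower_bound:
  assumes "0 < p" and "j \<in> J p u"
  shows "norm u powr p / p \<le> blinfun_apply j u"
proof -
  obtain x' where j: "j = (1 / p) *\<^sub>R x'" and x': "x' \<in> subdifferential (\<lambda>x. ereal (norm x powr p)) u"
    using assms(2) by (auto simp: J_def scale_op_def)
  have "ereal (blinfun_apply x' (0 - u)) + ereal (norm u powr p) \<le> ereal (norm (0::'a) powr p)"
    using x' unfolding subdifferential_def by blast
  then have "norm u powr p \<le> blinfun_apply x' u"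
    by (simp add: blinfun.minus_right)
  then show ?thesis
    using assms(1) by (simp add: j blinfun.scaleR_left divide_right_mono)
qed

lemma dom_fitzpatrick_iff_bounded:
  "(x, x') \<in> dom_fitzpatrick A \<longleftrightarrow>
     gra A \<noteq> {} \<and>
     (\<exists>M. \<forall>(a, a') \<in> gra A. blinfun_apply a' x + blinfun_apply x' a - blinfun_apply a' a \<le> M)"
    (is "?L \<longleftrightarrow> ?N \<and> ?R")
proof
  assume L: ?L
  have "?N"
    using L by (auto simp: dom_fitzpatrick_def fitzpatrick_def bot_ereal_def)
  moreover obtain M where M: "fitzpatrick A (x, x') = ereal M"
    using L by (cases "fitzpatrick A (x, x')") (auto simp: dom_fitzpatrick_def)
  have "blinfun_apply a' x + blinfun_apply x' a - blinfun_apply a' a \<le> M" if "(a, a') \<in> gra A" for a a'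
  proof -
    have "ereal (blinfun_apply a' x + blinfun_apply x' a - blinfun_apply a' a) \<le> fitzpatrick A (x, x')"
      unfolding fitzpatrick_def using that by (auto intro: SUP_upper2)
    then show ?thesis by (simp add: M)
  qed
  ultimately show "?N \<and> ?R" by blast
next
  assume "?N \<and> ?R"
  then obtain a a' M where a: "(a, a') \<in> gra A"
    and M: "\<forall>(a, a') \<in> gra A. blinfun_apply a' x + blinfun_apply x' a - blinfun_apply a' a \<le> M"
    by auto
  have "fitzpatrick A (x, x') \<le> ereal M"
    unfolding fitzpatrick_def using M by (auto intro!: SUP_least)
  moreover have
    "ereal (blinfun_apply a' x + blinfun_apply x' a - blinfun_apply a' a) \<le> fitzpatrick A (x, x')"
    unfolding fitzpatrick_def using a by (auto intro: SUP_upper2)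
  ultimately show ?L
    by (cases "fitzpatrick A (x, x')") (auto simp: dom_fitzpatrick_def)
qed

lemma convex_dom_fitzpatrick: "convex (dom_fitzpatrick A)"
proof (rule convexI, clarify)
  fix x y :: 'a and x' y' :: "'a \<Rightarrow>\<^sub>L real" and u v :: real
  assume x: "(x, x') \<in> dom_fitzpatrick A" and y: "(y, y') \<in> dom_fitzpatrick A"
    and uv: "0 \<le> u" "0 \<le> v" "u + v = 1"
  obtain M N where
    M: "\<And>a a'. (a, a') \<in> gra A \<Longrightarrow> blinfun_apply a' x + blinfun_apply x' a - blinfun_apply a' a \<le> M"
    and N: "\<And>a a'. (a, a') \<in> gra A \<Longrightarrow> blinfun_apply a' y + blinfun_apply y' a - blinfun_apply a' a \<le> N"
    and ne: "gra A \<noteq> {}"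
    using x y unfolding dom_fitzpatrick_iff_bounded by blast
  have "blinfun_apply a' (u *\<^sub>R x + v *\<^sub>R y) + blinfun_apply (u *\<^sub>R x' + v *\<^sub>R y') a - blinfun_apply a' a
          \<le> u * M + v * N" if a: "(a, a') \<in> gra A" for a a'
  proof -
    have "blinfun_apply a' a = u * blinfun_apply a' a + v * blinfun_apply a' a"
      using uv(3) by (metis distrib_right mult_1)
    then have "blinfun_apply a' (u *\<^sub>R x + v *\<^sub>R y) + blinfun_apply (u *\<^sub>R x' + v *\<^sub>R y') a
          - blinfun_apply a' a
        = u * (blinfun_apply a' x + blinfun_apply x' a - blinfun_apply a' a)
          + v * (blinfun_apply a' y + blinfun_apply y' a - blinfun_apply a' a)"
      by (simp add: blinfun.add_left blinfun.add_right blinfun.scaleR_left blinfun.scaleR_right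
          algebra_simps)
    also have "\<dots> \<le> u * M + v * N"
      using M[OF a] N[OF a] uv by (intro add_mono mult_left_mono)
    finally show ?thesis .
  qed
  then show "u *\<^sub>R (x, x') + v *\<^sub>R (y, y') \<in> dom_fitzpatrick A"
    using ne unfolding scaleR_Pair add_Pair dom_fitzpatrick_iff_bounded by blast
qed

lemma monotone_gra_subset_dom_fitzpatrick:
  assumes "monotone_op A"
  shows "gra A \<subseteq> dom_fitzpatrick A"
proof (clarify)
  fix x x' assume x: "(x, x') \<in> gra A"
  have "blinfun_apply a' x + blinfun_apply x' a - blinfun_apply a' a \<le> blinfun_apply x' x"
    if a: "(a, a') \<in> gra A" for a a'
  proof -
    have "0 \<le> blinfun_apply (x' - a') (x - a)"
      using assms x a unfolding monotone_op_def by blast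
    then show ?thesis
      by (simp add: blinfun.diff_left blinfun.diff_right)
  qed
  then show "(x, x') \<in> dom_fitzpatrick A"
    using x by (auto simp: dom_fitzpatrick_iff_bounded)
qed

lemma convex_hull_dom_subset_proj_dom_fitzpatrick:
  assumes "monotone_op A"
  shows "convex hull (dom_op A) \<subseteq> fst ` dom_fitzpatrick A"
proof (rule hull_minimal)
  show "dom_op A \<subseteq> fst ` dom_fitzpatrick A"
    using monotone_gra_subset_dom_fitzpatrick[OF assms] by (force simp: dom_op_def gra_def)
  show "convex (fst ` dom_fitzpatrick A)"
    by (intro convex_linear_image linear_fst convex_dom_fitzpatrick)
qed

text \<open>How failure of monotone relatedness turns the growth of \<open>J p\<close> into growth of the terms
  \<open>a' (z - a)\<close> that enter the Fitzpatrick function.\<close>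

lemma not_related_imp_large_pairing:
  assumes "0 < p" and "0 \<le> c"
    and "\<not> monotonically_related (z, 0) (gra (sum_op A (scale_op c (\<lambda>x. J p (x - z)))))"
  obtains a a' where "(a, a') \<in> gra A" "c * (norm (a - z) powr p / p) < blinfun_apply a' (z - a)"
proof -
  obtain a a' j where a: "a' \<in> A a" and j: "j \<in> J p (a - z)"
    and neg: "blinfun_apply (0 - (a' + c *\<^sub>R j)) (z - a) < 0"
    using assms(3)
    by (auto simp: monotonically_related_def gra_def sum_op_def scale_op_def not_le)
  have "c * (norm (a - z) powr p / p) \<le> c * blinfun_apply j (a - z)"
    using J_pairing_lower_bound[OF assms(1) j] assms(2) by (rule mult_left_mono)
  also have "\<dots> < blinfun_apply a' (z - a)"
    using neg by (simp add: blinfun.diff_left blinfun.diff_right blinfun.add_left blinfun.minus_left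
        blinfun.scaleR_left algebra_simps)
  finally show thesis
    using a that by (simp add: gra_def)
qed

text \<open>The set \<open>S\<close> serves only to keep \<open>dom_op A\<close> at a positive distance from \<open>z\<close>; the exponent
  \<open>p \<ge> 1\<close> makes \<open>t\<^sup>p\<close> dominate \<open>d\<^sup>p\<^sup>-\<^sup>1 t\<close> for \<open>t \<ge> d\<close>, so that large \<open>c\<close> outweighs the linear term
  \<open>\<parallel>z'\<parallel> t\<close>.\<close>

lemma proj_dom_fitzpatrick_subset_closure:
  assumes p: "1 \<le> p" and S: "dom_op A \<subseteq> S"
    and ev: "\<And>z. z \<notin> closure S \<Longrightarrow>
      \<forall>\<^sub>F c in at_top. \<not> monotonically_related (z, 0) (gra (sum_op A (scale_op c (\<lambda>x. J p (x - z)))))"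
  shows "fst ` dom_fitzpatrick A \<subseteq> closure S"
proof clarsimp
  fix z z' assume z: "(z, z') \<in> dom_fitzpatrick A"
  show "z \<in> closure S"
  proof (rule ccontr)
    assume out: "z \<notin> closure S"
    then obtain d where d: "0 < d" and far: "\<And>y. y \<in> S \<Longrightarrow> d \<le> norm (y - z)"
      unfolding closure_approachable by (auto simp: dist_norm not_less)
    obtain M where M: "\<And>a a'. (a, a') \<in> gra A \<Longrightarrow>
        blinfun_apply a' z + blinfun_apply z' a - blinfun_apply a' a \<le> M"
      using z unfolding dom_fitzpatrick_iff_bounded by blast
    \<comment> \<open>A coefficient \<open>(c / p) d\<^sup>p\<^sup>-\<^sup>1 \<ge> K\<close> makes \<open>d ((c / p) d\<^sup>p\<^sup>-\<^sup>1 - \<parallel>z'\<parallel>) + z' z\<close> at least \<open>M\<close>.\<close>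
    define K where "K = norm z' + \<bar>M - blinfun_apply z' z\<bar> / d"
    have "\<forall>\<^sub>F c in at_top. K * p / d powr (p - 1) \<le> c \<and> 0 \<le> c \<and>
        \<not> monotonically_related (z, 0) (gra (sum_op A (scale_op c (\<lambda>x. J p (x - z)))))"
      by (intro eventually_conj eventually_ge_at_top ev[OF out])
    then obtain c where cK: "K * p / d powr (p - 1) \<le> c" and c: "0 \<le> c"
      and nr: "\<not> monotonically_related (z, 0) (gra (sum_op A (scale_op c (\<lambda>x. J p (x - z)))))"
      using eventually_happens'[OF trivial_limit_at_top_linorder] by blast
    have p0: "0 < p" using p by simp
    obtain a a' where a: "(a, a') \<in> gra A"
      and big: "c * (norm (a - z) powr p / p) < blinfun_apply a' (z - a)"
      using not_related_imp_large_pairing[OF p0 c nr] by blast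
    define t where "t = norm (a - z)"
    have "a \<in> S" using a S by (auto simp: gra_def dom_op_def)
    then have t: "d \<le> t" using far by (simp add: t_def)
    have "K \<le> c / p * d powr (p - 1)"
      using cK p0 d by (simp add: field_simps)
    also have "\<dots> \<le> c / p * t powr (p - 1)"
      using c p0 p d t by (intro mult_left_mono powr_mono2) auto
    finally have "K * t \<le> c / p * t powr (p - 1) * t"
      using d t by (intro mult_right_mono) auto
    also have "\<dots> = c * (t powr p / p)"
      using d t by (simp add: powr_mult_base mult.assoc mult.commute[of _ t])
    finally have Kt: "K * t < blinfun_apply a' (z - a)"
      using big by (simp add: t_def)
    have "\<bar>M - blinfun_apply z' z\<bar> \<le> \<bar>M - blinfun_apply z' z\<bar> / d * t"
    proof -
      have "\<bar>M - blinfun_apply z' z\<bar> / d * d \<le> \<bar>M - blinfun_apply z' z\<bar> / d * t"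
        using d t by (intro mult_left_mono) auto
      then show ?thesis using d by simp
    qed
    then have "norm z' * t + (M - blinfun_apply z' z) \<le> K * t"
      by (simp add: K_def distrib_right)
    moreover have "\<bar>blinfun_apply z' (a - z)\<bar> \<le> norm z' * t"
      using norm_blinfun[of z' "a - z"] by (simp add: t_def)
    ultimately have "M < blinfun_apply a' (z - a) + blinfun_apply z' (a - z) + blinfun_apply z' z"
      using Kt by linarith
    then show False
      using M[OF a] by (simp add: blinfun.diff_right)
  qed
qed

theorem theorem3p3:
  fixes A :: "'a::banach \<Rightarrow> ('a \<Rightarrow>\<^sub>L real) set" and p :: real
  assumes "1 \<le> p" and "monotone_op A"
  shows
    "((\<forall>z. z \<notin> closure (dom_op A) \<longrightarrow>
         (\<forall>\<^sub>F c in at_top. maximally_monotone (sum_op A (scale_op c (\<lambda>x. J p (x - z))))))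
       \<longrightarrow> nearly_convex (dom_op A) \<and>
           closure (dom_op A) = closure (convex hull (dom_op A)) \<and>
           closure (convex hull (dom_op A)) = closure (fst ` dom_fitzpatrick A))
     \<and>
     ((\<forall>z. z \<notin> closure (convex hull (dom_op A)) \<longrightarrow>
         (\<forall>\<^sub>F c in at_top.
            \<not> monotonically_related (z, 0) (gra (sum_op A (scale_op c (\<lambda>x. J p (x - z)))))))
       \<longrightarrow> closure (convex hull (dom_op A)) = closure (fst ` dom_fitzpatrick A))"
proof (intro conjI[where P = "_ \<longrightarrow> _"] impI)
  note hull = convex_hull_dom_subset_proj_dom_fitzpatrick[OF assms(2)]
  {
    assume max: "\<forall>z. z \<notin> closure (dom_op A) \<longrightarrow>
      (\<forall>\<^sub>F c in at_top. maximally_monotone (sum_op A (scale_op c (\<lambda>x. J p (x - z)))))"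
    have "fst ` dom_fitzpatrick A \<subseteq> closure (dom_op A)"
    proof (rule proj_dom_fitzpatrick_subset_closure[OF assms(1) subset_refl])
      fix z assume z: "z \<notin> closure (dom_op A)"
      then have "A z = {}"
        using closure_subset[of "dom_op A"] by (auto simp: dom_op_def)
      then have "0 \<notin> sum_op A (scale_op c (\<lambda>x. J p (x - z))) z" for c
        by (simp add: sum_op_def)
      then show "\<forall>\<^sub>F c in at_top.
          \<not> monotonically_related (z, 0) (gra (sum_op A (scale_op c (\<lambda>x. J p (x - z)))))"
        using max z maximally_monotone_contains_related by (blast intro: eventually_mono)
    qed
    then have "closure (fst ` dom_fitzpatrick A) \<subseteq> closure (dom_op A)"
      by (simp add: closure_minimal)
    moreover have "closure (dom_op A) \<subseteq> closure (convex hull (dom_op A))"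
      by (intro closure_mono hull_subset)
    moreover have "closure (convex hull (dom_op A)) \<subseteq> closure (fst ` dom_fitzpatrick A)"
      by (intro closure_mono hull)
    ultimately have eq: "closure (dom_op A) = closure (convex hull (dom_op A))"
      and eq': "closure (convex hull (dom_op A)) = closure (fst ` dom_fitzpatrick A)"
      by auto
    moreover have "nearly_convex (dom_op A)"
      unfolding nearly_convex_def eq by (intro convex_closure convex_convex_hull)
    ultimately show "nearly_convex (dom_op A) \<and>
        closure (dom_op A) = closure (convex hull (dom_op A)) \<and>
        closure (convex hull (dom_op A)) = closure (fst ` dom_fitzpatrick A)"
      by blast
  next
    assume nr: "\<forall>z. z \<notin> closure (convex hull (dom_op A)) \<longrightarrow>
      (\<forall>\<^sub>F c in at_top.
        \<not> monotonically_related (z, 0) (gra (sum_op A (scale_op c (\<lambda>x. J p (x - z))))))"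
    have "fst ` dom_fitzpatrick A \<subseteq> closure (convex hull (dom_op A))"
      using nr by (intro proj_dom_fitzpatrick_subset_closure[OF assms(1) hull_subset]) blast
    then show "closure (convex hull (dom_op A)) = closure (fst ` dom_fitzpatrick A)"
      using hull by (intro equalityI closure_mono closure_minimal) auto
  }
qed

end
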